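(* Let $(X,\triangleright)$ be a quasi rack and assume that $L^0_x(x)=x$ for all $x\in X$. Then the derived map $r_\triangleright:X\times X\to X\times X$, $r_\triangleright(x,y)=\left(L^0_x(y),\,L_y(x)\right)$, associated to $(X,\triangleright)$ is a quasi non-degenerate solution.
   Context: Juxtaposition of maps denotes composition, $(fg)(x)=f(g(x))$. For a map $f:X\to X$, a relative inverse of $f$ is a map $f^-:X\to X$ with $ff^-f=f$, $f^-ff^-=f^-$, $ff^-=f^-f$; it is unique if it exists, and $f^0:=ff^-=f^-f$. A (left) shelf $(X,\triangleright)$ is a set $X$ with a binary operation such that $x\triangleright(y\triangleright z)=(x\triangleright y)\triangleright(x\triangleright z)$ for all $x,y,z$; write $L_x(y)=x\triangleright y$. A quasi rack is a shelf such that every $L_x$ has a relative inverse $L_x^-$ and $L_x^0L_y=L_yL_x^0$ for all $x,y\in X$, where $L^0_x=L_xL_x^-=L_x^-L_x$. A solution is a pair $(X,r)$ with $r:X\times X\to X\times X$ satisfying $(r\times\mathrm{id}_X)(\mathrm{id}_X\times r)(r\times\mathrm{id}_X)=(\mathrm{id}_X\times r)(r\times\mathrm{id}_X)(\mathrm{id}_X\times r)$; write $r(x,y)=(\lambda_x(y),\rho_y(x))$. It is quasi left non-degenerate if every $\lambda_x$ has a relative inverse $\lambda_x^-$ and $\lambda_x^0\lambda_y=\lambda_y\lambda_x^0$ for all $x,y$; quasi right non-degenerate if every $\rho_x$ has a relative inverse $\rho_x^-$ and $\rho_x^0\rho_y=\rho_y\rho_x^0$ for all $x,y$; quasi non-degenerate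 if both. *)

theory Defs imports Main
begin

text \<open>The underlying set of a shelf or of a solution is the universe of the type \<open>'a\<close>.\<close>

definition is_relative_inverse :: "('a \<Rightarrow> 'a) \<Rightarrow> ('a \<Rightarrow> 'a) \<Rightarrow> bool" where
  "is_relative_inverse f g \<longleftrightarrow> f \<circ> g \<circ> f = f \<and> g \<circ> f \<circ> g = g \<and> f \<circ> g = g \<circ> f"

definition has_relative_inverse :: "('a \<Rightarrow> 'a) \<Rightarrow> bool" where
  "has_relative_inverse f \<longleftrightarrow> (\<exists>g. is_relative_inverse f g)"

lemma relative_inverse_unique:
  assumes "is_relative_inverse f g" and "is_relative_inverse f h"
  shows "g = h"
proof
  fix x
  have g: "\<And>y. f (g (f y)) = f y" "\<And>y. g (f (g y)) = g y" "\<And>y. f (g y) = g (f y)"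
    using assms(1) unfolding is_relative_inverse_def fun_eq_iff o_def by blast+
  have h: "\<And>y. f (h (f y)) = f y" "\<And>y. h (f (h y)) = h y" "\<And>y. f (h y) = h (f y)"
    using assms(2) unfolding is_relative_inverse_def fun_eq_iff o_def by blast+
  have "g (f x) = h (f x)"
    by (metis g h)
  then show "g x = h x"
    by (metis g h)
qed

text \<open>The maps \<open>f\<^sup>-\<close> and \<open>f\<^sup>0 = f f\<^sup>-\<close>; both are meaningful only if \<open>f\<close> has a relative inverse.\<close>

definition relative_inverse :: "('a \<Rightarrow> 'a) \<Rightarrow> ('a \<Rightarrow> 'a)" where
  "relative_inverse f = (THE g. is_relative_inverse f g)"

definition relative_idem :: "('a \<Rightarrow> 'a) \<Rightarrow> ('a \<Rightarrow> 'a)" where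
  "relative_idem f = f \<circ> relative_inverse f"

lemma relative_inverse_eqI: "is_relative_inverse f g \<Longrightarrow> relative_inverse f = g"
  unfolding relative_inverse_def by (blast intro: relative_inverse_unique)

lemma is_relative_inverse_relative_inverse:
  "has_relative_inverse f \<Longrightarrow> is_relative_inverse f (relative_inverse f)"
  using relative_inverse_eqI unfolding has_relative_inverse_def by blast

lemma relative_idem_commute:
  "has_relative_inverse f \<Longrightarrow> relative_idem f = relative_inverse f \<circ> f"
  using is_relative_inverse_relative_inverse
  by (auto simp: relative_idem_def is_relative_inverse_def)

definition shelf :: "('a \<Rightarrow> 'a \<Rightarrow> 'a) \<Rightarrow> bool" where
  "shelf L \<longleftrightarrow> (\<forall>x y z. L x (L y z) = L (L x y) (L x z))"

text \<open>The condition shared by the left translations of a quasi rack and by the two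
  component families of a quasi non-degenerate solution.\<close>

definition quasi_bijective_family :: "('a \<Rightarrow> 'a \<Rightarrow> 'a) \<Rightarrow> bool" where
  "quasi_bijective_family F \<longleftrightarrow>
    (\<forall>x. has_relative_inverse (F x)) \<and>
    (\<forall>x y. relative_idem (F x) \<circ> F y = F y \<circ> relative_idem (F x))"

text \<open>For a binary operation \<open>L\<close>, the partial application \<open>L x\<close> is the left translation by \<open>x\<close>.\<close>

definition quasi_rack :: "('a \<Rightarrow> 'a \<Rightarrow> 'a) \<Rightarrow> bool" where
  "quasi_rack L \<longleftrightarrow> shelf L \<and> quasi_bijective_family L"

text \<open>The maps \<open>r \<times> id\<close> and \<open>id \<times> r\<close> on triples.\<close>

definition on_first_two :: "('a \<times> 'a \<Rightarrow> 'a \<times> 'a) \<Rightarrow> 'a \<times> 'a \<times> 'a \<Rightarrow> 'a \<times> 'a \<times> 'a" where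
  "on_first_two r = (\<lambda>(x, y, z). (fst (r (x, y)), snd (r (x, y)), z))"

definition on_last_two :: "('a \<times> 'a \<Rightarrow> 'a \<times> 'a) \<Rightarrow> 'a \<times> 'a \<times> 'a \<Rightarrow> 'a \<times> 'a \<times> 'a" where
  "on_last_two r = (\<lambda>(x, y, z). (x, r (y, z)))"

definition solution :: "('a \<times> 'a \<Rightarrow> 'a \<times> 'a) \<Rightarrow> bool" where
  "solution r \<longleftrightarrow>
    on_first_two r \<circ> on_last_two r \<circ> on_first_two r =
    on_last_two r \<circ> on_first_two r \<circ> on_last_two r"

text \<open>The components of \<open>r (x, y) = (\<lambda>\<^sub>x y, \<rho>\<^sub>y x)\<close>; the subscript is the first argument.\<close>

definition lam :: "('a \<times> 'a \<Rightarrow> 'a \<times> 'a) \<Rightarrow> 'a \<Rightarrow> 'a \<Rightarrow> 'a" where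
  "lam r x y = fst (r (x, y))"

definition rho :: "('a \<times> 'a \<Rightarrow> 'a \<times> 'a) \<Rightarrow> 'a \<Rightarrow> 'a \<Rightarrow> 'a" where
  "rho r y x = snd (r (x, y))"

definition quasi_left_nondegenerate :: "('a \<times> 'a \<Rightarrow> 'a \<times> 'a) \<Rightarrow> bool" where
  "quasi_left_nondegenerate r \<longleftrightarrow> quasi_bijective_family (lam r)"

definition quasi_right_nondegenerate :: "('a \<times> 'a \<Rightarrow> 'a \<times> 'a) \<Rightarrow> bool" where
  "quasi_right_nondegenerate r \<longleftrightarrow> quasi_bijective_family (rho r)"

definition quasi_nondegenerate :: "('a \<times> 'a \<Rightarrow> 'a \<times> 'a) \<Rightarrow> bool" where
  "quasi_nondegenerate r \<longleftrightarrow> quasi_left_nondegenerate r \<and> quasi_right_nondegenerate r"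

definition derived_map :: "('a \<Rightarrow> 'a \<Rightarrow> 'a) \<Rightarrow> 'a \<times> 'a \<Rightarrow> 'a \<times> 'a" where
  "derived_map L = (\<lambda>(x, y). (relative_idem (L x) y, L y x))"

end

theory Submission imports Defs
begin

text \<open>
  Write \<open>E x\<close> for the idempotent \<open>L\<^sub>x\<^sup>0\<close> and \<open>x \<triangleright> y\<close> for \<open>L x y\<close>. In a quasi rack the maps
  \<open>E x\<close> commute with all left translations, hence with each other. Since
  \<open>derived_map L (x, y) = (E x y, L y x)\<close>, its right components are the left translations
  themselves and its left components are commuting idempotents; this gives quasi
  non-degeneracy.

  The braid equation rests on comparing translations on the image of an idempotent. On the image
  of \<open>E x\<close>, the map \<open>L x\<close> is invertible, so self-distributivity says there that \<open>L (x \<triangleright> y)\<close> is a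
  conjugate of \<open>L y\<close>; as idempotents commute with translations, conjugation leaves them alone and
  \<open>E (x \<triangleright> y)\<close> agrees with \<open>E y\<close> (\<open>idem_left_mult\<close>). Likewise \<open>L (E x y)\<close> agrees with \<open>L y\<close>
  (\<open>left_mult_idem\<close>). The assumption \<open>E x x = x\<close> makes it possible to drop the restriction to the
  image of \<open>E x\<close>: it yields \<open>E x y \<triangleright> x = y \<triangleright> x\<close> and then \<open>E (E x y) E (y \<triangleright> x) = E x E y\<close>
  (\<open>idem_exchange\<close>), which is the first coordinate of the braid equation. The other two
  coordinates follow by inserting idempotents that change nothing where they stand and then
  replacing translations by others that agree with them on the image.
\<close>

locale quasi_rack_operation =
  fixes L :: "'a \<Rightarrow> 'a \<Rightarrow> 'a"
  assumes quasi_rack: "quasi_rack L"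
begin

abbreviation I :: "'a \<Rightarrow> 'a \<Rightarrow> 'a" where "I x \<equiv> relative_inverse (L x)"
abbreviation E :: "'a \<Rightarrow> 'a \<Rightarrow> 'a" where "E x \<equiv> relative_idem (L x)"

lemma self_distrib: "L (L x y) (L x z) = L x (L y z)"
  using quasi_rack by (simp add: quasi_rack_def shelf_def)

lemma is_inverse: "is_relative_inverse (L x) (I x)"
  using quasi_rack
  by (simp add: quasi_rack_def quasi_bijective_family_def is_relative_inverse_relative_inverse)

lemma mult_inverse: "L x (I x a) = E x a"
  by (simp add: relative_idem_def)

lemma inverse_mult: "I x (L x a) = E x a"
  using is_inverse[of x] by (simp add: is_relative_inverse_def relative_idem_def fun_eq_iff)

lemma idem_mult [simp]: "E x (L x a) = L x a"
  using is_inverse[of x] by (metis comp_apply is_relative_inverse_def relative_idem_def)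

lemma mult_idem [simp]: "L x (E x a) = L x a"
  by (metis idem_mult inverse_mult mult_inverse)

lemma idem_idem [simp]: "E x (E x a) = E x a"
  by (metis idem_mult mult_inverse)

lemma idem_mult_commute: "E x (L y a) = L y (E x a)"
  using quasi_rack by (simp add: quasi_rack_def quasi_bijective_family_def fun_eq_iff)

text \<open>A map \<open>h\<close> commuting with \<open>f = L y\<close> commutes with \<open>E y = f f\<^sup>-\<close>, because both products
  equal \<open>E y h E y\<close>: the image of \<open>h E y = f h f\<^sup>-\<close> is fixed by \<open>E y\<close>, and \<open>f h E y = f h\<close>
  gives \<open>E y h E y = E y h\<close> after applying \<open>f\<^sup>-\<close>.\<close>

lemma idem_commute: "E x (E y a) = E y (E x a)"
proof -
  have "E x (E y a) = L y (E x (I y a))"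
    by (metis idem_mult_commute mult_inverse)
  then have "E y (E x (E y a)) = E x (E y a)"
    by simp
  moreover have "E y (E x (E y a)) = E y (E x a)"
  proof -
    have "L y (E x (E y a)) = L y (E x a)"
      by (metis idem_mult_commute mult_idem)
    then show ?thesis
      by (metis inverse_mult)
  qed
  ultimately show ?thesis
    by simp
qed

text \<open>A commuting family of idempotents is quasi bijective, because each idempotent is its own
  relative inverse.\<close>

lemma quasi_bijective_family_idem: "quasi_bijective_family E"
proof -
  have inv: "is_relative_inverse (E x) (E x)" for x
    by (simp add: is_relative_inverse_def fun_eq_iff)
  then have "relative_idem (E x) = E x" for x
    using relative_inverse_eqI[OF inv[of x]]
    by (simp add: relative_idem_def[of "E x"] fun_eq_iff)
  with inv show ?thesis
    by (auto simp: quasi_bijective_family_def has_relative_inverse_def fun_eq_iff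
        intro: idem_commute)
qed

lemma quasi_nondegenerate_derived_map: "quasi_nondegenerate (derived_map L)"
proof -
  have "lam (derived_map L) = E" "rho (derived_map L) = L"
    by (simp_all add: lam_def rho_def derived_map_def fun_eq_iff)
  then show ?thesis
    using quasi_bijective_family_idem quasi_rack
    by (simp add: quasi_nondegenerate_def quasi_left_nondegenerate_def
        quasi_right_nondegenerate_def quasi_rack_def)
qed

text \<open>Put \<open>w = x \<triangleright> y\<close>, so that \<open>L w L x = L x L y\<close>. The right side is unchanged by \<open>E y\<close> and the
  left side by \<open>E w\<close>, and these idempotents may be moved to any position. Cancelling \<open>L w\<close> in one
  case and \<open>L x\<close>, \<open>L y\<close> in the other shows that both restrictions equal \<open>E w E y E x\<close>.\<close>

lemma idem_left_mult: "E (L x y) (E x a) = E y (E x a)"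
proof -
  let ?w = "L x y"
  have "L ?w (L x (E y b)) = L ?w (L x b)" for b
    by (simp add: self_distrib)
  from this[of "I x a"] have "L ?w (E y (E x a)) = L ?w (E x a)"
    by (simp add: idem_mult_commute[symmetric] mult_inverse)
  then have w: "E ?w (E y (E x a)) = E ?w (E x a)"
    by (metis inverse_mult)
  have "L x (L y (E ?w a)) = L x (L y a)"
    by (metis self_distrib idem_mult_commute idem_mult)
  then have "E x (L y (E ?w a)) = E x (L y a)"
    by (metis inverse_mult)
  then have "L y (E ?w (E x a)) = L y (E x a)"
    by (simp add: idem_mult_commute idem_commute[of ?w x])
  then have "E y (E ?w (E x a)) = E y (E x a)"
    by (metis inverse_mult)
  with w show ?thesis
    by (simp add: idem_commute[of ?w y])
qed

text \<open>Self-distributivity sees \<open>y\<close> only through \<open>x \<triangleright> y\<close>, which equals \<open>x \<triangleright> E x y\<close>; cancelling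
  the outer \<open>L x\<close> leaves \<open>E x\<close>.\<close>

lemma left_mult_idem: "L (E x y) (E x a) = L y (E x a)"
proof -
  have "L x (L (E x y) a) = L x (L y a)"
    using self_distrib[of x "E x y" a] self_distrib[of x y a] by simp
  then have "E x (L (E x y) a) = E x (L y a)"
    by (metis inverse_mult)
  then show ?thesis
    by (simp add: idem_mult_commute)
qed

lemma idem_left_idem: "E (E x y) (E x a) = E y (E x a)"
  using idem_left_mult[of x "E x y" a] idem_left_mult[of x y a] by simp

end

locale fixing_quasi_rack = quasi_rack_operation +
  assumes idem_self [simp]: "E x x = x"
begin

text \<open>Since \<open>x = E x x\<close>, the point \<open>y \<triangleright> x\<close> is also the translate of \<open>x\<close> by \<open>E x y\<close>. Hence its
  idempotent agrees with \<open>E x\<close> on the image of \<open>E (E x y)\<close>, and there remains \<open>E x E (E x y)\<close>,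
  in which \<open>E (E x y)\<close> reduces to \<open>E y\<close>.\<close>

lemma idem_exchange: "E (E x y) (E (L y x) a) = E x (E y a)"
proof -
  have "L (E x y) x = L y x"
    using left_mult_idem[of x y x] by simp
  then have "E (L y x) (E (E x y) a) = E x (E (E x y) a)"
    using idem_left_mult[of "E x y" x a] by simp
  also have "\<dots> = E x (E y a)"
    using idem_left_idem[of x y a] by (simp add: idem_commute[of x])
  finally show ?thesis
    by (simp add: idem_commute[of "E x y"])
qed

lemma braid_second: "L (E (L y x) z) (E x y) = E (L (E y z) x) (L z y)"
proof -
  \<comment> \<open>Both sides equal \<open>E x (L z y)\<close>: the left one because \<open>E x y\<close> lies in the image of
    \<open>E (L y x)\<close>, the right one because \<open>L z y\<close> lies in the image of \<open>E (E y z)\<close>.\<close>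
  have "E (E x y) (E (L y x) y) = E x y"
    using idem_exchange[of x y y] by simp
  then have "E (L y x) (E x y) = E x y"
    by (metis idem_commute idem_idem)
  then have "L (E (L y x) z) (E x y) = L z (E x y)"
    using left_mult_idem[of "L y x" z "E x y"] by simp
  moreover have "E (E y z) (L z y) = L z y"
    using idem_exchange[of y z "L z y"] by (simp add: idem_mult_commute[of y z])
  then have "E (L (E y z) x) (L z y) = E x (L z y)"
    using idem_left_mult[of "E y z" x "L z y"] by simp
  ultimately show ?thesis
    by (simp add: idem_mult_commute)
qed

text \<open>Self-distributivity would apply if \<open>E y z\<close> were \<open>z\<close>. The translations by these two points
  agree on the image of \<open>E y\<close>, and \<open>idem_exchange\<close> supplies \<open>E y E z\<close> from the idempotents of
  the two translations on the left.\<close>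

lemma braid_third: "L (L z y) (L (E y z) x) = L z (L y x)"
proof -
  let ?v = "E y z" and ?w = "L z y"
  have "L ?w (L ?v x) = L ?w (E ?v (E ?w (L ?v x)))"
    by (simp add: idem_commute[of ?v ?w])
  also have "E ?v (E ?w (L ?v x)) = E y (E z (L ?v x))"
    by (rule idem_exchange)
  also have "\<dots> = L ?v (E y (E z x))"
    by (simp only: idem_mult_commute)
  also have "\<dots> = L z (E y (E z x))"
    by (rule left_mult_idem)
  also have "L ?w (L z (E y (E z x))) = L z (L y (E z x))"
    by (simp add: self_distrib)
  also have "\<dots> = L z (L y x)"
    by (simp add: idem_mult_commute[symmetric])
  finally show ?thesis .
qed

lemma solution_derived_map: "solution (derived_map L)"
  by (auto simp: solution_def on_first_two_def on_last_two_def derived_map_def fun_eq_iff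
      idem_exchange braid_second braid_third)

end

theorem corollary2p17:
  fixes L :: "'a \<Rightarrow> 'a \<Rightarrow> 'a"
  assumes "quasi_rack L"
    and "\<And>x. relative_idem (L x) x = x"
  shows "solution (derived_map L) \<and> quasi_nondegenerate (derived_map L)"
proof -
  interpret fixing_quasi_rack L
    by unfold_locales (use assms in auto)
  show ?thesis
    using solution_derived_map quasi_nondegenerate_derived_map by blast
qed

end
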